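(* Let $S$ be a semiring and let $T$ be a multiplicatively closed subset of $S$. For each $k$-ideal $I$ of $T^{-1}S$ put $I^c:=\{x\in S : x/1\in I\}$, and let $C:=\{I^c : I \text{ is a } k\text{-ideal of } T^{-1}S\}$. Then there is a one-to-one correspondence between the proper $k$-strongly irreducible ideals of $T^{-1}S$ and the proper $k$-strongly irreducible ideals of $S$ contained in $C$ (that is, which are members of $C$) which do not meet $T$.
   Context: A semiring is a commutative semiring $(S,+,0,\cdot,1)$ with multiplicative identity $1$ and additive identity $0$ that is multiplicatively absorbing. An ideal is a nonempty subset closed under addition and under multiplication by elements of $S$. A $k$-ideal is an ideal $I$ such that $x+y\in I$ and $y\in I$ imply $x\in I$. A $k$-ideal $I$ is $k$-strongly irreducible if for all $k$-ideals $A,B$ of the semiring, $A\cap B\subseteq I$ implies $A\subseteq I$ or $B\subseteq I$. A multiplicatively closed subset contains $1$ and is closed under products. $T^{-1}S$ denotes the localisation of $S$ at $T$, that is, the semiring of fractions $x/s$ with $x\in S$, $s\in T$. *)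

theory Defs
  imports "HOL-Algebra.Ring"
begin

text \<open>
  HOL-Algebra's \<open>ideal\<close> asks for an additive subgroup of a ring, which is meaningless
  over a semiring.  A commutative semiring is a structure satisfying both
  \<open>semiring\<close> and \<open>comm_monoid\<close>; the zero semiring is allowed.
\<close>

definition semiring_ideal :: "('a, 'm) ring_scheme \<Rightarrow> 'a set \<Rightarrow> bool" where
  "semiring_ideal S I \<longleftrightarrow>
     I \<subseteq> carrier S \<and> I \<noteq> {} \<and>
     (\<forall>x\<in>I. \<forall>y\<in>I. x \<oplus>\<^bsub>S\<^esub> y \<in> I) \<and>
     (\<forall>a\<in>carrier S. \<forall>x\<in>I. a \<otimes>\<^bsub>S\<^esub> x \<in> I)"

definition k_ideal :: "('a, 'm) ring_scheme \<Rightarrow> 'a set \<Rightarrow> bool" where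
  "k_ideal S I \<longleftrightarrow>
     semiring_ideal S I \<and>
     (\<forall>x\<in>carrier S. \<forall>y\<in>carrier S. x \<oplus>\<^bsub>S\<^esub> y \<in> I \<and> y \<in> I \<longrightarrow> x \<in> I)"

definition k_strongly_irreducible :: "('a, 'm) ring_scheme \<Rightarrow> 'a set \<Rightarrow> bool" where
  "k_strongly_irreducible S I \<longleftrightarrow>
     k_ideal S I \<and>
     (\<forall>A B. k_ideal S A \<and> k_ideal S B \<and> A \<inter> B \<subseteq> I \<longrightarrow> A \<subseteq> I \<or> B \<subseteq> I)"

definition proper_k_strongly_irreducible :: "('a, 'm) ring_scheme \<Rightarrow> 'a set \<Rightarrow> bool" where
  "proper_k_strongly_irreducible S I \<longleftrightarrow> k_strongly_irreducible S I \<and> I \<noteq> carrier S"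

text \<open>
  The extra factor \<open>u \<in> T\<close> is needed for transitivity, since \<open>T\<close> may contain
  non-cancellable elements (even zero, in which case the localisation is the zero semiring).
\<close>

definition frac_rel :: "('a, 'm) ring_scheme \<Rightarrow> 'a set \<Rightarrow> (('a \<times> 'a) \<times> ('a \<times> 'a)) set" where
  "frac_rel S T =
     {((x, s), (y, t)) | x s y t. x \<in> carrier S \<and> s \<in> T \<and> y \<in> carrier S \<and> t \<in> T \<and>
        (\<exists>u\<in>T. u \<otimes>\<^bsub>S\<^esub> (x \<otimes>\<^bsub>S\<^esub> t) = u \<otimes>\<^bsub>S\<^esub> (y \<otimes>\<^bsub>S\<^esub> s))}"

definition frac :: "('a, 'm) ring_scheme \<Rightarrow> 'a set \<Rightarrow> 'a \<Rightarrow> 'a \<Rightarrow> ('a \<times> 'a) set" where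
  "frac S T x s = frac_rel S T `` {(x, s)}"

text \<open>
  The unions below range over classes that all coincide, so they denote the common value;
  see \<open>localisation_add\<close> and \<open>localisation_mult\<close>.
\<close>

definition localisation :: "('a, 'm) ring_scheme \<Rightarrow> 'a set \<Rightarrow> (('a \<times> 'a) set) ring" where
  "localisation S T =
     \<lparr> carrier = (carrier S \<times> T) // frac_rel S T,
       mult = (\<lambda>X Y. \<Union>(x, s)\<in>X. \<Union>(y, t)\<in>Y. frac S T (x \<otimes>\<^bsub>S\<^esub> y) (s \<otimes>\<^bsub>S\<^esub> t)),
       one = frac S T \<one>\<^bsub>S\<^esub> \<one>\<^bsub>S\<^esub>,
       zero = frac S T \<zero>\<^bsub>S\<^esub> \<one>\<^bsub>S\<^esub>,
       add = (\<lambda>X Y. \<Union>(x, s)\<in>X. \<Union>(y, t)\<in>Y.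
                frac S T (x \<otimes>\<^bsub>S\<^esub> t \<oplus>\<^bsub>S\<^esub> y \<otimes>\<^bsub>S\<^esub> s) (s \<otimes>\<^bsub>S\<^esub> t)) \<rparr>"

definition contraction :: "('a, 'm) ring_scheme \<Rightarrow> 'a set \<Rightarrow> ('a \<times> 'a) set set \<Rightarrow> 'a set" where
  "contraction S T I = {x \<in> carrier S. frac S T x \<one>\<^bsub>S\<^esub> \<in> I}"

definition contracted_k_ideals :: "('a, 'm) ring_scheme \<Rightarrow> 'a set \<Rightarrow> 'a set set" where
  "contracted_k_ideals S T = {contraction S T I | I. k_ideal (localisation S T) I}"

locale semiring_fractions = semiring S + comm_monoid S + submonoid T S
  for S (structure) and T
begin

lemma T_carrier [simp, intro]: "s \<in> T \<Longrightarrow> s \<in> carrier S"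
  using subset by blast

lemma frac_relI:
  "\<lbrakk> x \<in> carrier S; s \<in> T; y \<in> carrier S; t \<in> T; u \<in> T; u \<otimes> (x \<otimes> t) = u \<otimes> (y \<otimes> s) \<rbrakk>
    \<Longrightarrow> ((x, s), (y, t)) \<in> frac_rel S T"
  unfolding frac_rel_def by blast

lemma frac_relE:
  assumes "((x, s), (y, t)) \<in> frac_rel S T"
  obtains u where "x \<in> carrier S" "s \<in> T" "y \<in> carrier S" "t \<in> T" "u \<in> T"
    "u \<otimes> (x \<otimes> t) = u \<otimes> (y \<otimes> s)"
  using assms unfolding frac_rel_def by blast

lemma frac_rel_equiv: "equiv (carrier S \<times> T) (frac_rel S T)"
proof (rule equivI)
  show "frac_rel S T \<subseteq> (carrier S \<times> T) \<times> (carrier S \<times> T)"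
    by (auto simp: frac_rel_def)
  show "refl_on (carrier S \<times> T) (frac_rel S T)"
    by (auto simp: refl_on_def intro!: frac_relI[where u = "\<one>"])
  show "sym (frac_rel S T)"
    unfolding sym_def frac_rel_def by (auto; metis)
  show "trans (frac_rel S T)"
  proof (rule transI, clarify)
    fix x s y t z r
    assume "((x, s), (y, t)) \<in> frac_rel S T" and "((y, t), (z, r)) \<in> frac_rel S T"
    then obtain u v where c: "x \<in> carrier S" "s \<in> T" "y \<in> carrier S" "t \<in> T" "u \<in> T"
        "z \<in> carrier S" "r \<in> T" "v \<in> T"
      and u: "u \<otimes> (x \<otimes> t) = u \<otimes> (y \<otimes> s)" and v: "v \<otimes> (y \<otimes> r) = v \<otimes> (z \<otimes> t)"
      by (elim frac_relE) blast
    have "(u \<otimes> (v \<otimes> t)) \<otimes> (x \<otimes> r) = (v \<otimes> r) \<otimes> (u \<otimes> (x \<otimes> t))"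
      using c by (simp add: m_ac)
    also have "\<dots> = (u \<otimes> s) \<otimes> (v \<otimes> (y \<otimes> r))"
      unfolding u using c by (simp add: m_ac)
    also have "\<dots> = (u \<otimes> (v \<otimes> t)) \<otimes> (z \<otimes> s)"
      unfolding v using c by (simp add: m_ac)
    finally show "((x, s), (z, r)) \<in> frac_rel S T"
      using c by (intro frac_relI[where u = "u \<otimes> (v \<otimes> t)"]) auto
  qed
qed

lemma frac_eq_iff:
  assumes "x \<in> carrier S" "s \<in> T" "y \<in> carrier S" "t \<in> T"
  shows "frac S T x s = frac S T y t \<longleftrightarrow> (\<exists>u\<in>T. u \<otimes> (x \<otimes> t) = u \<otimes> (y \<otimes> s))"
proof -
  have "frac S T x s = frac S T y t \<longleftrightarrow> ((x, s), (y, t)) \<in> frac_rel S T"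
    unfolding frac_def using eq_equiv_class_iff[OF frac_rel_equiv] assms by simp
  then show ?thesis
    using assms by (auto simp: frac_rel_def)
qed

lemma frac_eqI:
  "\<lbrakk> x \<in> carrier S; s \<in> T; y \<in> carrier S; t \<in> T; x \<otimes> t = y \<otimes> s \<rbrakk>
    \<Longrightarrow> frac S T x s = frac S T y t"
  by (subst frac_eq_iff) auto

lemma localisation_carrier:
  "carrier (localisation S T) = {frac S T x s | x s. x \<in> carrier S \<and> s \<in> T}"
  by (auto simp: localisation_def frac_def quotient_def)

lemma localisation_add:
  assumes "x \<in> carrier S" "s \<in> T" "y \<in> carrier S" "t \<in> T"
  shows "frac S T x s \<oplus>\<^bsub>localisation S T\<^esub> frac S T y t = frac S T (x \<otimes> t \<oplus> y \<otimes> s) (s \<otimes> t)"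
proof -
  let ?f = "\<lambda>(x, s) (y, t). frac S T (x \<otimes> t \<oplus> y \<otimes> s) (s \<otimes> t)"
  have "congruent2 (frac_rel S T) (frac_rel S T) ?f"
  proof (rule congruent2_commuteI[OF frac_rel_equiv], goal_cases)
    case (1 p q)
    then show ?case by (auto simp: m_ac a_ac)
  next
    case (2 p q w)
    obtain x s where p: "p = (x, s)" by force
    obtain y t where q: "q = (y, t)" by force
    obtain z r where w: "w = (z, r)" by force
    from 2 p q obtain u where c: "x \<in> carrier S" "s \<in> T" "y \<in> carrier S" "t \<in> T" "u \<in> T"
      and u: "u \<otimes> (x \<otimes> t) = u \<otimes> (y \<otimes> s)"
      by (auto elim: frac_relE)
    from 2 w have d: "z \<in> carrier S" "r \<in> T" by auto
    have "u \<otimes> ((z \<otimes> s \<oplus> x \<otimes> r) \<otimes> (r \<otimes> t))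
        = u \<otimes> (z \<otimes> s \<otimes> (r \<otimes> t)) \<oplus> (r \<otimes> r) \<otimes> (u \<otimes> (x \<otimes> t))"
      using c d by (simp add: l_distr r_distr m_ac)
    also have "\<dots> = u \<otimes> ((z \<otimes> t \<oplus> y \<otimes> r) \<otimes> (r \<otimes> s))"
      unfolding u using c d by (simp add: l_distr r_distr m_ac)
    finally show ?case
      unfolding p q w using c d by (auto simp: frac_eq_iff)
  qed
  from UN_equiv_class2[OF frac_rel_equiv frac_rel_equiv this, of "(x, s)" "(y, t)"] assms
  show ?thesis by (simp add: localisation_def frac_def case_prod_unfold)
qed

lemma localisation_mult:
  assumes "x \<in> carrier S" "s \<in> T" "y \<in> carrier S" "t \<in> T"
  shows "frac S T x s \<otimes>\<^bsub>localisation S T\<^esub> frac S T y t = frac S T (x \<otimes> y) (s \<otimes> t)"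
proof -
  let ?f = "\<lambda>(x, s) (y, t). frac S T (x \<otimes> y) (s \<otimes> t)"
  have "congruent2 (frac_rel S T) (frac_rel S T) ?f"
  proof (rule congruent2_commuteI[OF frac_rel_equiv], goal_cases)
    case (1 p q)
    then show ?case by (auto simp: m_ac)
  next
    case (2 p q w)
    obtain x s where p: "p = (x, s)" by force
    obtain y t where q: "q = (y, t)" by force
    obtain z r where w: "w = (z, r)" by force
    from 2 p q obtain u where c: "x \<in> carrier S" "s \<in> T" "y \<in> carrier S" "t \<in> T" "u \<in> T"
      and u: "u \<otimes> (x \<otimes> t) = u \<otimes> (y \<otimes> s)"
      by (auto elim: frac_relE)
    from 2 w have d: "z \<in> carrier S" "r \<in> T" by auto
    have "u \<otimes> ((z \<otimes> x) \<otimes> (r \<otimes> t)) = (z \<otimes> r) \<otimes> (u \<otimes> (x \<otimes> t))"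
      using c d by (simp add: m_ac)
    also have "\<dots> = u \<otimes> ((z \<otimes> y) \<otimes> (r \<otimes> s))"
      unfolding u using c d by (simp add: m_ac)
    finally show ?case
      unfolding p q w using c d by (auto simp: frac_eq_iff)
  qed
  from UN_equiv_class2[OF frac_rel_equiv frac_rel_equiv this, of "(x, s)" "(y, t)"] assms
  show ?thesis by (simp add: localisation_def frac_def case_prod_unfold)
qed

lemma localisation_one: "\<one>\<^bsub>localisation S T\<^esub> = frac S T \<one> \<one>"
  and localisation_zero: "\<zero>\<^bsub>localisation S T\<^esub> = frac S T \<zero> \<one>"
  by (simp_all add: localisation_def)

lemmas localisation_simps =
  localisation_add localisation_mult localisation_one localisation_zero

lemma localisation_cases:
  assumes "X \<in> carrier (localisation S T)"
  obtains x s where "X = frac S T x s" "x \<in> carrier S" "s \<in> T"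
  using assms unfolding localisation_carrier by blast

lemma frac_in_carrier [simp, intro]:
  "\<lbrakk> x \<in> carrier S; s \<in> T \<rbrakk> \<Longrightarrow> frac S T x s \<in> carrier (localisation S T)"
  unfolding localisation_carrier by blast

lemma localisation_comm_monoid: "comm_monoid (localisation S T)"
  by (rule comm_monoidI; (elim localisation_cases)?)
    (simp_all add: localisation_simps m_ac)

lemma localisation_abelian_monoid: "abelian_monoid (localisation S T)"
  by (rule abelian_monoidI; (elim localisation_cases)?)
    (simp_all add: localisation_simps l_distr r_distr m_ac a_ac)

lemma localisation_semiring: "semiring (localisation S T)"
proof (intro semiring.intro semiring_axioms.intro localisation_abelian_monoid
    comm_monoid.axioms(1)[OF localisation_comm_monoid])
qed ((elim localisation_cases; simp add: localisation_simps),
    rule frac_eqI, simp_all add: l_distr r_distr m_ac a_ac)+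

end

end

theory Submission
  imports Defs
begin

text \<open>
  Contraction is inverted on all \<open>k\<close>-ideals of the localisation by the fact that
  \<open>x/s \<in> I\<close> iff \<open>x \<in> I\<^sup>c\<close>, so it preserves and reflects inclusions and commutes with
  intersections; this pulls strong irreducibility of \<open>I\<^sup>c\<close> back to \<open>I\<close>.  For the other direction
  the set \<open>A\<^sup>e\<close> of fractions with numerator in a \<open>k\<close>-ideal \<open>A\<close> is again a \<open>k\<close>-ideal, and
  \<open>A\<^sup>e \<inter> B\<^sup>e\<close> contains only fractions that lie in \<open>(A \<inter> B)\<^sup>e\<close>, so an inclusion
  \<open>A \<inter> B \<subseteq> I\<^sup>c\<close> extends to \<open>A\<^sup>e \<inter> B\<^sup>e \<subseteq> I\<close>.
\<close>

section \<open>Closure properties of \<open>k\<close>-ideals\<close>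

lemma k_ideal_carrier: "k_ideal S I \<Longrightarrow> x \<in> I \<Longrightarrow> x \<in> carrier S"
  unfolding k_ideal_def semiring_ideal_def by blast

lemma k_ideal_nonempty: "k_ideal S I \<Longrightarrow> I \<noteq> {}"
  unfolding k_ideal_def semiring_ideal_def by blast

lemma k_ideal_add: "k_ideal S I \<Longrightarrow> x \<in> I \<Longrightarrow> y \<in> I \<Longrightarrow> x \<oplus>\<^bsub>S\<^esub> y \<in> I"
  unfolding k_ideal_def semiring_ideal_def by blast

lemma k_ideal_mult: "k_ideal S I \<Longrightarrow> a \<in> carrier S \<Longrightarrow> x \<in> I \<Longrightarrow> a \<otimes>\<^bsub>S\<^esub> x \<in> I"
  unfolding k_ideal_def semiring_ideal_def by blast

lemma k_ideal_subtractive: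
  "\<lbrakk> k_ideal S I; x \<in> carrier S; y \<in> carrier S; x \<oplus>\<^bsub>S\<^esub> y \<in> I; y \<in> I \<rbrakk> \<Longrightarrow> x \<in> I"
  unfolding k_ideal_def by blast

context semiring_fractions
begin

section \<open>Extension of \<open>k\<close>-ideals to the localisation\<close>

text \<open>Only some representative has to have its numerator in \<open>A\<close>; another
  representative \<open>x/s\<close> of the same fraction may have \<open>x\<close> outside
  \<open>A\<close>.\<close>

definition extension :: "'a set \<Rightarrow> ('a \<times> 'a) set set" where
  "extension A = {frac S T x s | x s. x \<in> A \<and> s \<in> T}"

text \<open>Tests membership on an arbitrary representative. Equality of fractions holds up to a
  factor from \<open>T\<close>: \<open>x/s = a/t\<close> gives
  \<open>(u \<otimes> t) \<otimes> x = (u \<otimes> s) \<otimes> a\<close>, which lies in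
  \<open>A\<close> when \<open>a\<close> does. Conversely \<open>x/s\<close> equals the fraction of
  \<open>u \<otimes> x\<close> over \<open>u \<otimes> s\<close>.\<close>

lemma frac_in_extension_iff:
  assumes A: "k_ideal S A" and x: "x \<in> carrier S" and s: "s \<in> T"
  shows "frac S T x s \<in> extension A \<longleftrightarrow> (\<exists>u\<in>T. u \<otimes> x \<in> A)"
proof
  assume "frac S T x s \<in> extension A"
  then obtain a t where a: "a \<in> A" "t \<in> T" "frac S T x s = frac S T a t"
    unfolding extension_def by blast
  have ac: "a \<in> carrier S" using A a(1) by (rule k_ideal_carrier)
  obtain u where u: "u \<in> T" "u \<otimes> (x \<otimes> t) = u \<otimes> (a \<otimes> s)"
    using a(3) frac_eq_iff[OF x s ac a(2)] by blast
  have "(u \<otimes> t) \<otimes> x = (u \<otimes> s) \<otimes> a"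
    using u a(2) x s ac by (simp add: m_ac)
  also have "\<dots> \<in> A" using k_ideal_mult[OF A _ a(1)] u(1) s by simp
  finally show "\<exists>u\<in>T. u \<otimes> x \<in> A" using u(1) a(2) by blast
next
  assume "\<exists>u\<in>T. u \<otimes> x \<in> A"
  then obtain u where u: "u \<in> T" "u \<otimes> x \<in> A" by blast
  have "frac S T x s = frac S T (u \<otimes> x) (u \<otimes> s)"
    using u(1) x s by (intro frac_eqI) (simp_all add: m_ac)
  then show "frac S T x s \<in> extension A"
    unfolding extension_def using u s by blast
qed

lemma extension_carrier: "k_ideal S A \<Longrightarrow> extension A \<subseteq> carrier (localisation S T)"
  unfolding extension_def by (auto dest: k_ideal_carrier)

text \<open>Closure under the operations is read off representatives with numerator in
  \<open>A\<close>. For subtractivity the representative of \<open>X\<close> is arbitrary, so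
  denominators are cleared and subtractivity of \<open>A\<close> is applied in
  \<open>S\<close>.\<close>

lemma k_ideal_extension:
  assumes A: "k_ideal S A"
  shows "k_ideal (localisation S T) (extension A)"
proof -
  let ?L = "localisation S T"
  have "extension A \<noteq> {}"
    using k_ideal_nonempty[OF A] one_closed unfolding extension_def by blast
  moreover have "X \<oplus>\<^bsub>?L\<^esub> Y \<in> extension A" if X: "X \<in> extension A" and Y: "Y \<in> extension A" for X Y
  proof -
    obtain x s where x: "X = frac S T x s" "x \<in> A" "s \<in> T"
      using X unfolding extension_def by blast
    obtain y t where y: "Y = frac S T y t" "y \<in> A" "t \<in> T"
      using Y unfolding extension_def by blast
    note c = x y
    have d: "x \<in> carrier S" "y \<in> carrier S" using c A by (auto dest: k_ideal_carrier)
    have "t \<otimes> x \<oplus> s \<otimes> y \<in> A" using c A by (simp add: k_ideal_add k_ideal_mult)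
    then have "x \<otimes> t \<oplus> y \<otimes> s \<in> A" using c d by (simp add: m_ac)
    then show ?thesis unfolding extension_def
      using c d by (auto simp: localisation_add)
  qed
  moreover have "R \<otimes>\<^bsub>?L\<^esub> X \<in> extension A" if R: "R \<in> carrier ?L" and X: "X \<in> extension A" for R X
  proof -
    obtain x s where c: "X = frac S T x s" "x \<in> A" "s \<in> T"
      using X unfolding extension_def by blast
    obtain r t where d: "R = frac S T r t" "r \<in> carrier S" "t \<in> T"
      using R by (rule localisation_cases)
    have "r \<otimes> x \<in> A" "x \<in> carrier S" using k_ideal_mult[OF A] k_ideal_carrier[OF A] c d by auto
    then show ?thesis unfolding extension_def
      using c d by (auto simp: localisation_mult)
  qed
  moreover have "X \<in> extension A"
    if X: "X \<in> carrier ?L" and Y: "Y \<in> carrier ?L"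
      and XY: "X \<oplus>\<^bsub>?L\<^esub> Y \<in> extension A" and YA: "Y \<in> extension A" for X Y
  proof -
    obtain x s where x: "X = frac S T x s" "x \<in> carrier S" "s \<in> T"
      using X by (rule localisation_cases)
    obtain y t where y: "Y = frac S T y t" "y \<in> carrier S" "t \<in> T"
      using Y by (rule localisation_cases)
    obtain u where u: "u \<in> T" "u \<otimes> (x \<otimes> t \<oplus> y \<otimes> s) \<in> A"
      using XY x y frac_in_extension_iff[OF A, of "x \<otimes> t \<oplus> y \<otimes> s" "s \<otimes> t"]
      by (auto simp: localisation_add)
    obtain v where v: "v \<in> T" "v \<otimes> y \<in> A"
      using YA y frac_in_extension_iff[OF A] by blast
    \<comment> \<open>The factor \<open>v\<close> turns the second summand into a multiple of
      \<open>v \<otimes> y\<close>, which is in \<open>A\<close>; subtractivity of \<open>A\<close>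
      then leaves a \<open>T\<close>-multiple of \<open>x\<close>.\<close>
    have "v \<otimes> (u \<otimes> (x \<otimes> t \<oplus> y \<otimes> s)) \<in> A"
      using k_ideal_mult[OF A _ u(2)] v(1) by simp
    moreover have "v \<otimes> (u \<otimes> (x \<otimes> t \<oplus> y \<otimes> s)) = (u \<otimes> v \<otimes> t) \<otimes> x \<oplus> (u \<otimes> s) \<otimes> (v \<otimes> y)"
      using x y u(1) v(1) by (simp add: r_distr m_ac)
    ultimately have sum: "(u \<otimes> v \<otimes> t) \<otimes> x \<oplus> (u \<otimes> s) \<otimes> (v \<otimes> y) \<in> A"
      by simp
    have "(u \<otimes> s) \<otimes> (v \<otimes> y) \<in> A"
      using k_ideal_mult[OF A _ v(2)] u(1) x(3) by simp
    then have "(u \<otimes> v \<otimes> t) \<otimes> x \<in> A"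
      using x y u(1) v(1) by (intro k_ideal_subtractive[OF A _ _ sum]) simp_all
    moreover have "u \<otimes> v \<otimes> t \<in> T" using u(1) v(1) y(3) by simp
    ultimately show ?thesis unfolding x(1) using frac_in_extension_iff[OF A x(2,3)] by blast
  qed
  ultimately show ?thesis
    unfolding k_ideal_def semiring_ideal_def using extension_carrier[OF A] by blast
qed

text \<open>Different multipliers \<open>u\<close> and \<open>v\<close> may bring the numerator
  \<open>x\<close> into \<open>A\<close> and into \<open>B\<close>. Their product brings it into
  both, since ideals absorb the other factor.\<close>

lemma extension_Int_subset:
  assumes A: "k_ideal S A" and B: "k_ideal S B"
  shows "extension A \<inter> extension B \<subseteq> extension (A \<inter> B)"
proof
  fix X assume X: "X \<in> extension A \<inter> extension B"
  then have "X \<in> carrier (localisation S T)" using extension_carrier[OF A] by blast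
  then obtain x s where x: "X = frac S T x s" "x \<in> carrier S" "s \<in> T"
    by (rule localisation_cases)
  obtain u where u: "u \<in> T" "u \<otimes> x \<in> A" using X x frac_in_extension_iff[OF A] by blast
  obtain v where v: "v \<in> T" "v \<otimes> x \<in> B" using X x frac_in_extension_iff[OF B] by blast
  have "v \<otimes> (u \<otimes> x) \<in> A" "u \<otimes> (v \<otimes> x) \<in> B"
    using u v A B by (auto intro: k_ideal_mult)
  then have "u \<otimes> v \<otimes> x \<in> A \<inter> B"
    using u(1) v(1) x(2) by (simp add: m_ac)
  moreover have "frac S T x s = frac S T (u \<otimes> v \<otimes> x) (u \<otimes> v \<otimes> s)"
    using u(1) v(1) x by (intro frac_eqI) (simp_all add: m_ac)
  moreover have "u \<otimes> v \<otimes> s \<in> T" using u(1) v(1) x(3) by simp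
  ultimately show "X \<in> extension (A \<inter> B)"
    unfolding x(1) extension_def by blast
qed

section \<open>Contraction and its adjunction with extension\<close>

text \<open>Multiplication by \<open>s/1\<close> turns \<open>x/s\<close> into \<open>x/1\<close>,
  and multiplication by \<open>1/s\<close> turns it back, so an ideal contains both or
  neither.\<close>

lemma frac_in_k_ideal_iff:
  assumes I: "k_ideal (localisation S T) I" and x: "x \<in> carrier S" and s: "s \<in> T"
  shows "frac S T x s \<in> I \<longleftrightarrow> x \<in> contraction S T I"
proof
  assume "frac S T x s \<in> I"
  then have "frac S T s \<one> \<otimes>\<^bsub>localisation S T\<^esub> frac S T x s \<in> I"
    using I s by (intro k_ideal_mult) auto
  moreover have "frac S T s \<one> \<otimes>\<^bsub>localisation S T\<^esub> frac S T x s = frac S T x \<one>"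
    using x s by (simp add: localisation_mult) (rule frac_eqI; simp add: m_ac)
  ultimately show "x \<in> contraction S T I" using x by (simp add: contraction_def)
next
  assume "x \<in> contraction S T I"
  then have "frac S T x \<one> \<in> I" by (simp add: contraction_def)
  then have "frac S T \<one> s \<otimes>\<^bsub>localisation S T\<^esub> frac S T x \<one> \<in> I"
    using I s by (intro k_ideal_mult) auto
  then show "frac S T x s \<in> I" using x s by (simp add: localisation_mult)
qed

text \<open>Membership of a fraction depends only on its numerator, so a \<open>k\<close>-ideal of
  the localisation is determined by its contraction. This yields injectivity of the
  correspondence.\<close>

lemma contraction_subset_iff:
  assumes A: "k_ideal (localisation S T) A" and B: "k_ideal (localisation S T) B"
  shows "contraction S T A \<subseteq> contraction S T B \<longleftrightarrow> A \<subseteq> B"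
proof
  assume sub: "contraction S T A \<subseteq> contraction S T B"
  show "A \<subseteq> B"
  proof
    fix X assume X: "X \<in> A"
    then have "X \<in> carrier (localisation S T)" by (rule k_ideal_carrier[OF A])
    then obtain x s where "X = frac S T x s" "x \<in> carrier S" "s \<in> T"
      by (rule localisation_cases)
    then show "X \<in> B"
      using X sub frac_in_k_ideal_iff[OF A] frac_in_k_ideal_iff[OF B] by blast
  qed
qed (auto simp: contraction_def)

text \<open>The adjunction between extension and contraction, stated for subsets so that it applies
  directly to an intersection.\<close>

lemma extension_subset_iff:
  assumes I: "k_ideal (localisation S T) I" and A: "A \<subseteq> carrier S"
  shows "extension A \<subseteq> I \<longleftrightarrow> A \<subseteq> contraction S T I"
proof
  show "A \<subseteq> contraction S T I" if "extension A \<subseteq> I"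
  proof
    fix x assume "x \<in> A"
    then have "frac S T x \<one> \<in> extension A" unfolding extension_def using one_closed by blast
    with that \<open>x \<in> A\<close> A show "x \<in> contraction S T I" by (auto simp: contraction_def)
  qed
  show "extension A \<subseteq> I" if "A \<subseteq> contraction S T I"
    using that A frac_in_k_ideal_iff[OF I] unfolding extension_def by blast
qed

text \<open>The contraction is the preimage of \<open>I\<close> under the homomorphism
  \<open>x\<close> to \<open>x/1\<close>, whose laws are \<open>add\<close> and \<open>mult\<close>.
  It is nonempty because it contains the numerator of any member of \<open>I\<close>.\<close>

lemma k_ideal_contraction:
  assumes I: "k_ideal (localisation S T) I"
  shows "k_ideal S (contraction S T I)"
proof -
  have add: "frac S T (x \<oplus> y) \<one> = frac S T x \<one> \<oplus>\<^bsub>localisation S T\<^esub> frac S T y \<one>"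
    if "x \<in> carrier S" "y \<in> carrier S" for x y
    using that by (simp add: localisation_add)
  have mult: "frac S T (x \<otimes> y) \<one> = frac S T x \<one> \<otimes>\<^bsub>localisation S T\<^esub> frac S T y \<one>"
    if "x \<in> carrier S" "y \<in> carrier S" for x y
    using that by (simp add: localisation_mult)
  obtain X where X: "X \<in> I" using k_ideal_nonempty[OF I] by blast
  then have "X \<in> carrier (localisation S T)" by (rule k_ideal_carrier[OF I])
  then obtain x s where "X = frac S T x s" "x \<in> carrier S" "s \<in> T"
    by (rule localisation_cases)
  with X have "contraction S T I \<noteq> {}" using frac_in_k_ideal_iff[OF I] by blast
  moreover have "x \<in> contraction S T I"
    if "x \<in> carrier S" "y \<in> carrier S" "x \<oplus> y \<in> contraction S T I" "y \<in> contraction S T I" for x y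
    using that k_ideal_subtractive[OF I, of "frac S T x \<one>" "frac S T y \<one>"]
    by (simp add: contraction_def add)
  moreover have "x \<oplus> y \<in> contraction S T I"
    if "x \<in> contraction S T I" "y \<in> contraction S T I" for x y
    using that by (simp add: contraction_def add k_ideal_add[OF I])
  moreover have "a \<otimes> x \<in> contraction S T I"
    if "a \<in> carrier S" "x \<in> contraction S T I" for a x
    using that by (simp add: contraction_def mult k_ideal_mult[OF I])
  moreover have "contraction S T I \<subseteq> carrier S"
    unfolding contraction_def by blast
  ultimately show ?thesis
    unfolding k_ideal_def semiring_ideal_def by blast
qed

section \<open>Transfer of properness and strong irreducibility\<close>

text \<open>If \<open>s\<close> in \<open>T\<close> lies in the contraction, then \<open>I\<close>
  contains \<open>s/s\<close>, which acts as the identity. In the other direction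
  \<open>\<one>\<close> is a common element.\<close>

lemma k_ideal_eq_carrier_iff:
  assumes I: "k_ideal (localisation S T) I"
  shows "I = carrier (localisation S T) \<longleftrightarrow> contraction S T I \<inter> T \<noteq> {}"
proof
  assume "I = carrier (localisation S T)"
  then have "\<one> \<in> contraction S T I \<inter> T" by (simp add: contraction_def)
  then show "contraction S T I \<inter> T \<noteq> {}" by blast
next
  assume "contraction S T I \<inter> T \<noteq> {}"
  then obtain s where s: "s \<in> T" "s \<in> contraction S T I" by blast
  then have ss: "frac S T s s \<in> I" using frac_in_k_ideal_iff[OF I] by blast
  show "I = carrier (localisation S T)"
  proof
    show "carrier (localisation S T) \<subseteq> I"
    proof
      fix X assume X: "X \<in> carrier (localisation S T)"
      then obtain x t where x: "X = frac S T x t" "x \<in> carrier S" "t \<in> T"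
        by (rule localisation_cases)
      have "X \<otimes>\<^bsub>localisation S T\<^esub> frac S T s s = X"
        using x s(1) by (simp add: localisation_mult) (rule frac_eqI; simp add: m_ac)
      then show "X \<in> I" using k_ideal_mult[OF I X ss] by simp
    qed
  qed (use k_ideal_carrier[OF I] in blast)
qed

lemma k_strongly_irreducible_contraction_iff:
  assumes I: "k_ideal (localisation S T) I"
  shows "k_strongly_irreducible S (contraction S T I) \<longleftrightarrow>
    k_strongly_irreducible (localisation S T) I"
proof
  assume irr: "k_strongly_irreducible S (contraction S T I)"
  have "A \<subseteq> I \<or> B \<subseteq> I"
    if A: "k_ideal (localisation S T) A" and B: "k_ideal (localisation S T) B"
      and sub: "A \<inter> B \<subseteq> I" for A B
  proof -
    have "contraction S T A \<inter> contraction S T B \<subseteq> contraction S T I"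
      using sub unfolding contraction_def by blast
    then have "contraction S T A \<subseteq> contraction S T I \<or> contraction S T B \<subseteq> contraction S T I"
      using irr k_ideal_contraction[OF A] k_ideal_contraction[OF B]
      unfolding k_strongly_irreducible_def by blast
    then show ?thesis
      by (simp add: contraction_subset_iff A B I)
  qed
  then show "k_strongly_irreducible (localisation S T) I"
    unfolding k_strongly_irreducible_def using I by blast
next
  assume irr: "k_strongly_irreducible (localisation S T) I"
  have "A \<subseteq> contraction S T I \<or> B \<subseteq> contraction S T I"
    if A: "k_ideal S A" and B: "k_ideal S B" and sub: "A \<inter> B \<subseteq> contraction S T I" for A B
  proof -
    have c: "A \<subseteq> carrier S" "B \<subseteq> carrier S" using A B by (auto dest: k_ideal_carrier)
    \<comment> \<open>The adjunction lifts the inclusion to the localisation here; at the end it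
      brings the chosen alternative back to \<open>S\<close>.\<close>
    then have "extension (A \<inter> B) \<subseteq> I"
      using sub extension_subset_iff[OF I, of "A \<inter> B"] by blast
    then have "extension A \<inter> extension B \<subseteq> I"
      using extension_Int_subset[OF A B] by blast
    then have "extension A \<subseteq> I \<or> extension B \<subseteq> I"
      using irr k_ideal_extension[OF A] k_ideal_extension[OF B]
      unfolding k_strongly_irreducible_def by blast
    then show ?thesis using extension_subset_iff[OF I] c by blast
  qed
  then show "k_strongly_irreducible S (contraction S T I)"
    unfolding k_strongly_irreducible_def using k_ideal_contraction[OF I] by blast
qed

lemma proper_k_strongly_irreducible_iff:
  assumes I: "k_ideal (localisation S T) I"
  shows "proper_k_strongly_irreducible (localisation S T) I \<longleftrightarrow>
    proper_k_strongly_irreducible S (contraction S T I) \<and> contraction S T I \<inter> T = {}"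
proof -
  \<comment> \<open>Properness of \<open>I\<close> amounts to disjointness of its contraction from
    \<open>T\<close>, and since \<open>\<one>\<close> lies in \<open>T\<close> this also makes the
    contraction proper.\<close>
  have "contraction S T I \<noteq> carrier S" if "contraction S T I \<inter> T = {}"
  proof
    assume "contraction S T I = carrier S"
    then have "\<one> \<in> contraction S T I \<inter> T" by simp
    with that show False by simp
  qed
  then show ?thesis
    unfolding proper_k_strongly_irreducible_def k_strongly_irreducible_contraction_iff[OF I]
      k_ideal_eq_carrier_iff[OF I] by metis
qed

end

theorem theorem5p3:
  fixes S :: "('a, 'm) ring_scheme" and T :: "'a set"
  assumes "semiring S" and "comm_monoid S" and "submonoid T S"
  shows "bij_betw (contraction S T)
           {I. proper_k_strongly_irreducible (localisation S T) I}
           {J. proper_k_strongly_irreducible S J \<and> J \<in> contracted_k_ideals S T \<and> J \<inter> T = {}}"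
proof -
  interpret semiring_fractions S T
    using assms by (rule semiring_fractions.intro)
  have ki: "k_ideal (localisation S T) I" if "proper_k_strongly_irreducible (localisation S T) I" for I
    using that unfolding proper_k_strongly_irreducible_def k_strongly_irreducible_def by blast
  show ?thesis
  proof (rule bij_betw_imageI)
    show "inj_on (contraction S T) {I. proper_k_strongly_irreducible (localisation S T) I}"
      by (rule inj_onI) (metis contraction_subset_iff ki mem_Collect_eq subset_antisym subset_refl)
    show "contraction S T ` {I. proper_k_strongly_irreducible (localisation S T) I} =
        {J. proper_k_strongly_irreducible S J \<and> J \<in> contracted_k_ideals S T \<and> J \<inter> T = {}}"
    proof (intro equalityI subsetI)
      fix J assume "J \<in> contraction S T ` {I. proper_k_strongly_irreducible (localisation S T) I}"
      then obtain I where I: "J = contraction S T I" "proper_k_strongly_irreducible (localisation S T) I"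
        by blast
      then show "J \<in> {J. proper_k_strongly_irreducible S J \<and> J \<in> contracted_k_ideals S T \<and> J \<inter> T = {}}"
        using proper_k_strongly_irreducible_iff[OF ki[OF I(2)]] ki[OF I(2)]
        unfolding contracted_k_ideals_def by blast
    next
      fix J assume "J \<in> {J. proper_k_strongly_irreducible S J \<and> J \<in> contracted_k_ideals S T \<and> J \<inter> T = {}}"
      \<comment> \<open>Membership in \<open>contracted_k_ideals\<close> supplies the preimage
        \<open>I\<close>; the equivalence for \<open>I\<close> then carries properness and
        irreducibility back from \<open>J\<close>.\<close>
      then obtain I where "J = contraction S T I" "k_ideal (localisation S T) I"
          "proper_k_strongly_irreducible S J" "J \<inter> T = {}"
        unfolding contracted_k_ideals_def by blast
      then show "J \<in> contraction S T ` {I. proper_k_strongly_irreducible (localisation S T) I}"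
        using proper_k_strongly_irreducible_iff by blast
    qed
  qed
qed

end
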